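(* For each $m\ge 1$ let $H_m$ be a 2-edge hypergraph. Then $f(m,H_m)$ is bounded as $m\to\infty$ if and only if $H_m\in\mathbf{EIP}_2$ for all but finitely many $m$.
   Context: A hypergraph is a finite set of distinct finite sets (its edges); $|F|$ denotes the number of edges of $F$, and a subgraph of $F$ is a subset of its edges. A copy of $H$ in $F$ is a set of edges of $F$ which, as a hypergraph, is isomorphic to $H$. $F$ is $H$-free if it contains no copy of $H$. Let $\mathrm{ex}(F,H)$ be the maximum number of edges of an $H$-free subgraph of $F$, and $f(m,H):=\min_{|F|=m}\mathrm{ex}(F,H)$, the minimum being over all hypergraphs $F$ with $m$ edges (not necessarily uniform). A $k$-edge hypergraph is a hypergraph with exactly $k$ edges. For $k\ge 2$, $\mathbf{EIP}_k$ is the set of all $k$-edge hypergraphs $\{A_1,\dots,A_k\}$ such that for every $1\le\ell\le k$ and all $I,J\in\binom{[k]}{\ell}$ we have $\left|\bigcap_{i\in I}A_i\right|=\left|\bigcap_{j\in J}A_j\right|$. *)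

theory Defs
  imports Main
begin

text \<open>
  A hypergraph is identified with its set of edges, so its vertices are the elements of
  the union of its edges; the empty set is allowed as an edge.
\<close>

definition hypergraph :: "'a set set \<Rightarrow> bool" where
  "hypergraph F \<longleftrightarrow> finite F \<and> (\<forall>A\<in>F. finite A)"

definition edge_hypergraph :: "nat \<Rightarrow> 'a set set \<Rightarrow> bool" where
  "edge_hypergraph k F \<longleftrightarrow> hypergraph F \<and> card F = k"

definition hypergraph_iso :: "'a set set \<Rightarrow> 'b set set \<Rightarrow> bool" where
  "hypergraph_iso G H \<longleftrightarrow> (\<exists>\<phi>. bij_betw \<phi> (\<Union>G) (\<Union>H) \<and> (\<lambda>A. \<phi> ` A) ` G = H)"

definition copy_in :: "'a set set \<Rightarrow> 'b set set \<Rightarrow> 'a set set \<Rightarrow> bool" where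
  "copy_in C H F \<longleftrightarrow> C \<subseteq> F \<and> hypergraph_iso C H"

definition is_free :: "'b set set \<Rightarrow> 'a set set \<Rightarrow> bool" where
  "is_free H F \<longleftrightarrow> \<not> (\<exists>C. copy_in C H F)"

text \<open>
  For a hypergraph \<open>F\<close> and nonempty \<open>H\<close> the maximum is over a finite set that contains 0,
  as the subgraph without edges is \<open>H\<close>-free.
\<close>

definition ex_num :: "'a set set \<Rightarrow> 'b set set \<Rightarrow> nat" where
  "ex_num F H = Max {card G | G. G \<subseteq> F \<and> is_free H G}"

text \<open>
  The function \<open>f(m, H)\<close>. Every hypergraph is isomorphic to one whose vertices are natural
  numbers, so letting \<open>F\<close> range over hypergraphs on \<open>nat\<close> loses nothing. The minimum is over
  a finite set of values, since \<open>ex_num F H \<le> card F = m\<close> (for nonempty \<open>H\<close>).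
\<close>

definition min_ex :: "nat \<Rightarrow> 'b set set \<Rightarrow> nat" where
  "min_ex m H = Min {ex_num F H | F :: nat set set. edge_hypergraph m F}"

definition EIP :: "nat \<Rightarrow> 'a set set set" where
  "EIP k = {H. edge_hypergraph k H \<and>
     (\<exists>A. bij_betw A {1..k} H \<and>
       (\<forall>l\<in>{1..k}. \<forall>I J. I \<subseteq> {1..k} \<and> card I = l \<and> J \<subseteq> {1..k} \<and> card J = l \<longrightarrow>
          card (\<Inter>i\<in>I. A i) = card (\<Inter>j\<in>J. A j)))}"

end

theory Submission
  imports Defs
begin

text \<open>
  A 2-edge hypergraph \<open>H\<close> lies in \<open>EIP 2\<close> exactly when its two edges have the same size, since
  for \<open>\<ell> = 2\<close> there is only one index set (\<open>EIP_2_iff_card_eq\<close>). The two cases behave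
  in opposite ways.

  If both edges have size \<open>a\<close> and meet in \<open>c < a\<close> points, take for \<open>F\<close> a sunflower with \<open>m\<close>
  edges of size \<open>a\<close> and a kernel of \<open>c\<close> points. Two edges are determined up to isomorphism by
  their sizes and the size of their intersection (\<open>hypergraph_iso_pair\<close>), so any two edges of
  \<open>F\<close> form a copy of \<open>H\<close>, and an \<open>H\<close>-free subgraph has at most one edge. Hence
  \<open>min_ex m H \<le> 1\<close> (\<open>min_ex_le_1\<close>). Finitely many exceptional \<open>m\<close> do no harm, because
  always \<open>min_ex m H \<le> m\<close>.

  If the edges of \<open>H\<close> have sizes \<open>a \<noteq> b\<close>, split an arbitrary \<open>F\<close> with \<open>m\<close> edges into the edges
  of size \<open>a\<close> and the others. A copy of \<open>H\<close> needs an edge of size \<open>a\<close> and an edge of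
  another size, so both parts are \<open>H\<close>-free, and one of them has at least \<open>m/2\<close> edges. Hence
  \<open>min_ex m H \<ge> m/2\<close> (\<open>half_le_min_ex\<close>), which is unbounded along any infinite set of \<open>m\<close>.
\<close>


section \<open>Bounds for the extremal numbers\<close>

lemma is_free_empty:
  assumes "H \<noteq> {}"
  shows "is_free H {}"
  using assms by (auto simp: is_free_def copy_in_def hypergraph_iso_def)

lemma card_le_ex_num:
  assumes "finite F" "G \<subseteq> F" "is_free H G"
  shows "card G \<le> ex_num F H"
  unfolding ex_num_def by (rule Max_ge) (use assms in auto)

lemma ex_num_leI:
  assumes "finite F" "H \<noteq> {}"
    and "\<And>G. G \<subseteq> F \<Longrightarrow> is_free H G \<Longrightarrow> card G \<le> n"
  shows "ex_num F H \<le> n"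
  unfolding ex_num_def
proof (rule Max.boundedI)
  show "{card G |G. G \<subseteq> F \<and> is_free H G} \<noteq> {}"
    using is_free_empty[OF assms(2)] by blast
qed (use assms in auto)

lemma ex_num_le_card:
  assumes "finite F" "H \<noteq> {}"
  shows "ex_num F H \<le> card F"
  using assms by (intro ex_num_leI) (auto intro: card_mono)

lemma finite_ex_num_values:
  assumes "H \<noteq> {}"
  shows "finite {ex_num F H | F :: nat set set. edge_hypergraph m F}"
proof (rule finite_subset)
  show "{ex_num F H | F :: nat set set. edge_hypergraph m F} \<subseteq> {..m}"
    using ex_num_le_card[OF _ assms] by (auto simp: edge_hypergraph_def hypergraph_def)
qed simp

lemma min_ex_le_ex_num:
  fixes F :: "nat set set"
  assumes "H \<noteq> {}" "edge_hypergraph m F"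
  shows "min_ex m H \<le> ex_num F H"
  unfolding min_ex_def
  by (rule Min_le[OF finite_ex_num_values[OF assms(1)]]) (use assms(2) in blast)

lemma edge_hypergraph_exists: "\<exists>F :: nat set set. edge_hypergraph m F"
proof
  show "edge_hypergraph m ((\<lambda>i. {i}) ` {..<m})"
    by (simp add: edge_hypergraph_def hypergraph_def card_image)
qed

lemma le_min_exI:
  assumes "H \<noteq> {}"
    and "\<And>F :: nat set set. edge_hypergraph m F \<Longrightarrow> n \<le> ex_num F H"
  shows "n \<le> min_ex m H"
  unfolding min_ex_def
proof (rule Min.boundedI[OF finite_ex_num_values[OF assms(1)]])
  show "{ex_num F H | F :: nat set set. edge_hypergraph m F} \<noteq> {}"
    using edge_hypergraph_exists by blast
qed (use assms(2) in auto)

lemma min_ex_le: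
  assumes "H \<noteq> {}"
  shows "min_ex m H \<le> m"
proof -
  obtain F :: "nat set set" where F: "edge_hypergraph m F"
    using edge_hypergraph_exists by blast
  have "min_ex m H \<le> ex_num F H"
    by (rule min_ex_le_ex_num[OF assms F])
  also have "\<dots> \<le> m"
    using ex_num_le_card[of F H] F assms by (simp add: edge_hypergraph_def hypergraph_def)
  finally show ?thesis .
qed


section \<open>Pairs of edges\<close>

lemma edge_hypergraph_2E:
  assumes "edge_hypergraph 2 H"
  obtains A B where "H = {A, B}" "A \<noteq> B" "finite A" "finite B"
proof -
  from assms obtain A B where "H = {A, B}" "A \<noteq> B"
    unfolding edge_hypergraph_def card_2_iff by blast
  then show ?thesis
    using that assms by (simp add: edge_hypergraph_def hypergraph_def)
qed

lemma EIP_2_iff_card_eq: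
  assumes "A \<noteq> B" "finite A" "finite B"
  shows "{A, B} \<in> EIP 2 \<longleftrightarrow> card A = card B"
proof
  assume "{A, B} \<in> EIP 2"
  then obtain e where e: "bij_betw e {1..2::nat} {A, B}"
    and *: "\<forall>l\<in>{1..2}. \<forall>I J. I \<subseteq> {1..2} \<and> card I = l \<and> J \<subseteq> {1..2} \<and> card J = l \<longrightarrow>
           card (\<Inter>i\<in>I. e i) = card (\<Inter>j\<in>J. e j)"
    unfolding EIP_def by auto
  have "card (e 1) = card (e 2)"
    using *[rule_format, of 1 "{1}" "{2}"] by simp
  moreover have "{1..2::nat} = {1, 2}"
    by auto
  with e have "{e 1, e 2} = {A, B}"
    by (simp add: bij_betw_def)
  ultimately show "card A = card B"
    by (metis doubleton_eq_iff)
next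
  assume eq: "card A = card B"
  define e where "e = (\<lambda>i::nat. if i = 1 then A else B)"
  have card_e: "card (e i) = card A" for i
    using eq by (simp add: e_def)
  have two: "{1..2::nat} = {1, 2}"
    by auto
  have e: "bij_betw e {1..2} {A, B}"
    unfolding two using assms(1) by (simp add: bij_betw_def inj_on_def e_def insert_commute)
  have "card (\<Inter>i\<in>I. e i) = card (\<Inter>j\<in>J. e j)"
    if l: "l \<in> {1..2}" and I: "I \<subseteq> {1..2}" "card I = l" and J: "J \<subseteq> {1..2}" "card J = l"
    for l I J
  proof (cases "l = 1")
    case True
    then obtain i j where "I = {i}" "J = {j}"
      using I J by (metis card_1_singletonE)
    then show ?thesis
      by (simp add: card_e)
  next
    case False
    then have "l = 2"
      using l by auto
    then have "I = {1..2}" "J = {1..2}"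
      using I J card_subset_eq[of "{1..2::nat}"] by simp_all
    then show ?thesis
      by simp
  qed
  then have "\<forall>l\<in>{1..2}. \<forall>I J. I \<subseteq> {1..2} \<and> card I = l \<and> J \<subseteq> {1..2} \<and> card J = l \<longrightarrow>
      card (\<Inter>i\<in>I. e i) = card (\<Inter>j\<in>J. e j)"
    by blast
  moreover have "edge_hypergraph 2 {A, B}"
    using assms by (simp add: edge_hypergraph_def hypergraph_def)
  ultimately show "{A, B} \<in> EIP 2"
    unfolding EIP_def using e by (intro CollectI conjI exI[of _ e])
qed


section \<open>Edges of equal size\<close>

text \<open>
  The Venn diagram of a pair of edges has three cells, and the three cardinalities in the
  hypotheses determine the sizes of the cells; bijections between corresponding cells are glued.
\<close>

lemma hypergraph_iso_pair:
  assumes fin: "finite A" "finite B" "finite C" "finite D"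
    and card: "card A = card C" "card B = card D" "card (A \<inter> B) = card (C \<inter> D)"
  shows "hypergraph_iso {A, B} {C, D}"
proof -
  have "card (A - B) = card (C - D)"
    using fin card by (simp add: card_Diff_subset_Int)
  then obtain g where g: "bij_betw g (A - B) (C - D)"
    using fin by (metis finite_same_card_bij finite_Diff)
  have "card (B - A) = card (D - C)"
    using fin card by (simp add: card_Diff_subset_Int Int_commute)
  then obtain h where h: "bij_betw h (B - A) (D - C)"
    using fin by (metis finite_same_card_bij finite_Diff)
  obtain f where f: "bij_betw f (A \<inter> B) (C \<inter> D)"
    using fin card(3) by (metis finite_same_card_bij finite_Int)
  define \<phi> where "\<phi> x = (if x \<in> B then if x \<in> A then f x else h x else g x)" for x
  have f': "bij_betw \<phi> (A \<inter> B) (C \<inter> D)"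
    using f by (rule bij_betw_cong[THEN iffD1, rotated]) (auto simp: \<phi>_def)
  have g': "bij_betw \<phi> (A - B) (C - D)"
    using g by (rule bij_betw_cong[THEN iffD1, rotated]) (auto simp: \<phi>_def)
  have h': "bij_betw \<phi> (B - A) (D - C)"
    using h by (rule bij_betw_cong[THEN iffD1, rotated]) (auto simp: \<phi>_def)
  have A: "bij_betw \<phi> A C"
    using bij_betw_combine[OF f' g'] by (auto simp: Int_Diff_Un)
  have "bij_betw \<phi> (A \<union> (B - A)) (C \<union> (D - C))"
    by (rule bij_betw_combine[OF A h']) auto
  then have "bij_betw \<phi> (\<Union>{A, B}) (\<Union>{C, D})"
    by simp
  moreover have "\<phi> ` B = D"
    using bij_betw_imp_surj_on[OF f'] bij_betw_imp_surj_on[OF h'] by blast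
  then have "(\<lambda>X. \<phi> ` X) ` {A, B} = {C, D}"
    using bij_betw_imp_surj_on[OF A] by simp
  ultimately show ?thesis
    unfolding hypergraph_iso_def by blast
qed

text \<open>
  The petals are the consecutive blocks of length \<open>d\<close> above the kernel \<open>{..<c}\<close>; they are
  nonempty, so the \<open>m\<close> edges are distinct.
\<close>

lemma sunflower_exists:
  fixes c d m :: nat
  assumes "d > 0"
  shows "\<exists>F :: nat set set. edge_hypergraph m F \<and> (\<forall>X\<in>F. card X = c + d) \<and>
           (\<forall>X\<in>F. \<forall>Y\<in>F. X \<noteq> Y \<longrightarrow> card (X \<inter> Y) = c)"
proof -
  define E where "E i = {..<c} \<union> {c + i * d..<c + i * d + d}" for i
  have card_E: "card (E i) = c + d" for i
    unfolding E_def by (subst card_Un_disjoint) auto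
  have Int_less: "E i \<inter> E j = {..<c}" if "i < j" for i j
  proof -
    have "Suc i * d \<le> j * d"
      using that by (intro mult_le_mono1) simp
    then show ?thesis
      by (auto simp: E_def)
  qed
  have Int: "E i \<inter> E j = {..<c}" if "i \<noteq> j" for i j
    using that Int_less[of i j] Int_less[of j i] by (metis Int_commute nat_neq_iff)
  have inj: "inj E"
  proof (rule injI, rule ccontr)
    fix i j assume "E i = E j" "i \<noteq> j"
    then have "E i = {..<c}"
      using Int[of i j] by simp
    then show False
      using card_E[of i] assms by simp
  qed
  show ?thesis
  proof (intro exI[of _ "E ` {..<m}"] conjI)
    show "edge_hypergraph m (E ` {..<m})"
      using card_image[OF inj_on_subset[OF inj subset_UNIV], of "{..<m}"]
      unfolding edge_hypergraph_def hypergraph_def by (auto simp: E_def)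
    show "\<forall>X\<in>E ` {..<m}. card X = c + d"
      by (simp add: card_E)
    show "\<forall>X\<in>E ` {..<m}. \<forall>Y\<in>E ` {..<m}. X \<noteq> Y \<longrightarrow> card (X \<inter> Y) = c"
      using Int by (metis (no_types, lifting) card_lessThan imageE)
  qed
qed

lemma min_ex_le_1:
  assumes "A \<noteq> B" "finite A" "finite B" "card A = card B"
  shows "min_ex m {A, B} \<le> 1"
proof -
  define c where "c = card (A \<inter> B)"
  \<comment> \<open>Distinct sets of equal size do not contain each other, so the petals are nonempty.\<close>
  have "A \<inter> B \<subset> A"
    using assms by (metis Int_lower1 card_subset_eq inf.order_iff psubsetI)
  then have "c < card A"
    unfolding c_def using assms(2) by (rule psubset_card_mono[rotated])
  then obtain F :: "nat set set" where F: "edge_hypergraph m F"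
    and size: "\<And>X. X \<in> F \<Longrightarrow> card X = card A"
    and meet: "\<And>X Y. X \<in> F \<Longrightarrow> Y \<in> F \<Longrightarrow> X \<noteq> Y \<Longrightarrow> card (X \<inter> Y) = c"
    using sunflower_exists[of "card A - c" m c] by auto
  have fin: "finite F" "\<And>X. X \<in> F \<Longrightarrow> finite X"
    using F by (auto simp: edge_hypergraph_def hypergraph_def)
  have "ex_num F {A, B} \<le> 1"
  proof (rule ex_num_leI)
    fix G assume G: "G \<subseteq> F" "is_free {A, B} G"
    have "X = Y" if "X \<in> G" "Y \<in> G" for X Y
    proof (rule ccontr)
      assume "X \<noteq> Y"
      moreover have "X \<in> F" "Y \<in> F"
        using that G(1) by auto
      ultimately have "hypergraph_iso {X, Y} {A, B}"
        using fin(2) size meet[of X Y] assms by (intro hypergraph_iso_pair) (simp_all add: c_def)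
      then have "copy_in {X, Y} {A, B} G"
        using that by (simp add: copy_in_def)
      then show False
        using G(2) by (auto simp: is_free_def)
    qed
    then show "card G \<le> 1"
      using card_le_Suc0_iff_eq[OF finite_subset[OF G(1) fin(1)]] by simp
  qed (use fin in auto)
  then show ?thesis
    using min_ex_le_ex_num[OF _ F, of "{A, B}"] by simp
qed


section \<open>Edges of different sizes\<close>

text \<open>An isomorphism is injective on vertices, so it preserves the sizes of edges.\<close>

lemma is_free_if_no_edge_of_card:
  assumes "A \<in> H" "\<And>X. X \<in> G \<Longrightarrow> card X \<noteq> card A"
  shows "is_free H G"
proof -
  have False if "C \<subseteq> G" and bij: "bij_betw \<phi> (\<Union>C) (\<Union>H)" and im: "(\<lambda>X. \<phi> ` X) ` C = H" for C \<phi>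
  proof -
    have "A \<in> (\<lambda>X. \<phi> ` X) ` C"
      using assms(1) by (simp only: im)
    then obtain X where X: "X \<in> C" "A = \<phi> ` X"
      by (rule imageE)
    have "inj_on \<phi> X"
      using bij_betw_imp_inj_on[OF bij] by (rule inj_on_subset) (rule Union_upper[OF X(1)])
    then have "card A = card X"
      by (simp add: X(2) card_image)
    moreover have "X \<in> G"
      using X(1) that(1) by (rule subsetD[rotated])
    ultimately show False
      using assms(2) by metis
  qed
  then show ?thesis
    unfolding is_free_def copy_in_def hypergraph_iso_def by blast
qed

lemma half_le_min_ex:
  assumes "A \<in> H" "B \<in> H" "card A \<noteq> card B"
  shows "m \<le> 2 * min_ex m H"
proof -
  \<comment> \<open>The bound is \<open>m/2\<close> rounded up: a minimum has to be compared with a natural number.\<close>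
  have "m div 2 + m mod 2 \<le> ex_num F H" if "edge_hypergraph m F" for F :: "nat set set"
  proof -
    have fin: "finite F" and m: "card F = m"
      using that by (auto simp: edge_hypergraph_def hypergraph_def)
    let ?P = "{X \<in> F. card X = card A}" and ?Q = "{X \<in> F. card X \<noteq> card A}"
    have "is_free H ?P"
      using assms by (intro is_free_if_no_edge_of_card[of B]) auto
    then have P: "card ?P \<le> ex_num F H"
      using fin by (intro card_le_ex_num) auto
    have "is_free H ?Q"
      using assms by (intro is_free_if_no_edge_of_card[of A]) auto
    then have Q: "card ?Q \<le> ex_num F H"
      using fin by (intro card_le_ex_num) auto
    have "?P \<union> ?Q = F"
      by blast
    then have "m \<le> card ?P + card ?Q"
      using card_Un_le[of ?P ?Q] m by simp
    with P Q show ?thesis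
      by presburger
  qed
  then have "m div 2 + m mod 2 \<le> min_ex m H"
    using assms(1) by (intro le_min_exI) auto
  then show ?thesis
    by presburger
qed


section \<open>Boundedness along a sequence\<close>

theorem proposition2p5:
  fixes H :: "nat \<Rightarrow> 'a set set"
  assumes "\<And>m. m \<ge> 1 \<Longrightarrow> edge_hypergraph 2 (H m)"
  shows "(\<exists>C::nat. \<forall>m\<ge>1. min_ex m (H m) \<le> C) \<longleftrightarrow> finite {m. m \<ge> 1 \<and> H m \<notin> EIP 2}"
proof
  assume "\<exists>C::nat. \<forall>m\<ge>1. min_ex m (H m) \<le> C"
  then obtain C where C: "\<And>m. m \<ge> 1 \<Longrightarrow> min_ex m (H m) \<le> C"
    by blast
  have "m \<le> 2 * C" if m: "m \<ge> 1" "H m \<notin> EIP 2" for m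
  proof -
    obtain A B where H: "H m = {A, B}" "A \<noteq> B" "finite A" "finite B"
      using edge_hypergraph_2E[OF assms[OF m(1)]] .
    then have "card A \<noteq> card B"
      using m(2) by (simp add: EIP_2_iff_card_eq)
    then have "m \<le> 2 * min_ex m (H m)"
      using H(1) by (intro half_le_min_ex[of A _ B]) auto
    then show ?thesis
      using C[OF m(1)] by linarith
  qed
  then show "finite {m. m \<ge> 1 \<and> H m \<notin> EIP 2}"
    unfolding finite_nat_set_iff_bounded_le by (intro exI[of _ "2 * C"]) simp
next
  assume "finite {m. m \<ge> 1 \<and> H m \<notin> EIP 2}"
  then obtain k where "\<forall>m\<in>{m. m \<ge> 1 \<and> H m \<notin> EIP 2}. m \<le> k"
    unfolding finite_nat_set_iff_bounded_le ..
  then have k: "m \<le> k" if "m \<ge> 1" "H m \<notin> EIP 2" for m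
    using that by simp
  have "min_ex m (H m) \<le> max 1 k" if m: "m \<ge> 1" for m
  proof -
    obtain A B where H: "H m = {A, B}" "A \<noteq> B" "finite A" "finite B"
      using edge_hypergraph_2E[OF assms[OF m]] .
    show ?thesis
    proof (cases "H m \<in> EIP 2")
      case True
      then have "card A = card B"
        using H by (simp add: EIP_2_iff_card_eq)
      then have "min_ex m (H m) \<le> 1"
        using H min_ex_le_1[of A B m] by simp
      then show ?thesis
        by simp
    next
      case False
      have "min_ex m (H m) \<le> m"
        using H(1) by (intro min_ex_le) simp
      then show ?thesis
        using k[OF m False] by simp
    qed
  qed
  then show "\<exists>C::nat. \<forall>m\<ge>1. min_ex m (H m) \<le> C"
    by blast
qed

end
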